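(* Let $T$ be a right Hopf monad on a right autonomous category $\mathcal{C}$. The following assertions are equivalent: (i) $T$ is semisimple; (ii) $T$ is separable; (iii) $T$ admits a cointegral $\Lambda\colon\mathbf 1\to T(\mathbf 1)$ such that $T_0\Lambda=\mathrm{id}_{\mathbf 1}$.
   Context: Conventions: categories are small, monoidal categories $(\mathcal{C},\otimes,\mathbf 1)$ are strict; composition of $f$ followed by $g$ is written $gf$; "functorial" means natural. Monads: a monad on $\mathcal{C}$ is $(T,\mu\colon T^2\to T,\eta\colon 1_{\mathcal C}\to T)$ with $\mu_XT(\mu_X)=\mu_X\mu_{T(X)}$, $\mu_X\eta_{T(X)}=\mathrm{id}=\mu_XT(\eta_X)$. A $T$-module is $(M,r)$ with $r\colon T(M)\to M$, $rT(r)=r\mu_M$, $r\eta_M=\mathrm{id}_M$; a $T$-linear morphism $f\colon(M,r)\to(N,s)$ satisfies $fr=sT(f)$. For a $T$-module $(M,r)$, $r$ is a $T$-linear morphism $(T(M),\mu_M)\to(M,r)$. Semisimple: the monad $T$ is semisimple if for every $T$-module $(M,r)$ the $T$-linear morphism $r\colon(T(M),\mu_M)\to(M,r)$ has a $T$-linear section. Separable: $T$ is separable if there exists a functorial morphism $\gamma\colon1_{\mathcal C}\to T^2$ such that $T(\mu_X)\gamma_{T(X)}=\mu_{T(X)}T(\gamma_X)$ and $\mu_X\gamma_X=\eta_X$ for all $X$; equivalently, one may choose $T$-linear sections of $r$ functorially in the $T$-module $(M,r)$. Bimonads: a bimonad on a monoidal category $\mathcal{C}$ is a monad $T$ equipped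 with natural $T_2(X,Y)\colon T(X\otimes Y)\to T(X)\otimes T(Y)$ and $T_0\colon T(\mathbf 1)\to\mathbf 1$ with $(\mathrm{id}\otimes T_2(Y,Z))T_2(X,Y\otimes Z)=(T_2(X,Y)\otimes \mathrm{id})T_2(X\otimes Y,Z)$, $(\mathrm{id}\otimes T_0)T_2(X,\mathbf 1)=\mathrm{id}=(T_0\otimes\mathrm{id})T_2(\mathbf 1,X)$, $T_2(X,Y)\mu_{X\otimes Y}=(\mu_X\otimes\mu_Y)T_2(T(X),T(Y))T(T_2(X,Y))$, $T_0\mu_{\mathbf 1}=T_0T(T_0)$, $T_2(X,Y)\eta_{X\otimes Y}=\eta_X\otimes\eta_Y$, $T_0\eta_{\mathbf 1}=\mathrm{id}_{\mathbf 1}$. A cointegral of a bimonad $T$ is a morphism $\Lambda\colon\mathbf 1\to T(\mathbf 1)$ with $\mu_{\mathbf 1}T(\Lambda)=\Lambda T_0$. Right Hopf monads: $\mathcal{C}$ is right autonomous if each object $X$ has a (chosen) right dual $(X^\vee,\widetilde{\mathrm{ev}}_X\colon X\otimes X^\vee\to\mathbf 1,\widetilde{\mathrm{coev}}_X\colon\mathbf 1\to X^\vee\otimes X)$. A right Hopf monad is a bimonad $T$ on a right autonomous category admitting a right antipode, i.e. a functorial family $s^r_X\colon T(T(X)^\vee)\to X^\vee$ such that for all $X$: $T_0T(\widetilde{\mathrm{ev}}_X)T(\mathrm{id}_X\otimes\eta_X^\vee)=\widetilde{\mathrm{ev}}_{T(X)}(\mathrm{id}_{T(X)}\otimes s^r_{T(X)}T(\mu_X^\vee))T_2(X,T(X)^\vee)$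 and $(\mathrm{id}_{X^\vee}\otimes\eta_X)\widetilde{\mathrm{coev}}_XT_0=(s^r_X\otimes\mu_X)T_2(T(X)^\vee,T(X))T(\widetilde{\mathrm{coev}}_{T(X)})$. *)

theory Defs
  imports Main
begin

text \<open>
  Categories are presented by a set of objects and a set of arrows, with \<open>g \<cdot> f\<close> denoting \<open>f\<close>
  followed by \<open>g\<close>.  All operations are total in HOL; the axioms constrain them only on actual
  objects and arrows.
\<close>

record ('o, 'a) cat =
  obj :: "'o set"
  arr :: "'a set"
  source :: "'a \<Rightarrow> 'o"
  target :: "'a \<Rightarrow> 'o"
  ident :: "'o \<Rightarrow> 'a" ("\<i>\<index>")
  comp :: "'a \<Rightarrow> 'a \<Rightarrow> 'a" (infixl "\<cdot>\<index>" 60)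

definition hom :: "('o, 'a, 'x) cat_scheme \<Rightarrow> 'o \<Rightarrow> 'o \<Rightarrow> 'a set" where
  "hom C X Y = {f \<in> arr C. source C f = X \<and> target C f = Y}"

locale category =
  fixes C :: "('o, 'a, 'x) cat_scheme" (structure)
  assumes source_obj: "f \<in> arr C \<Longrightarrow> source C f \<in> obj C"
    and target_obj: "f \<in> arr C \<Longrightarrow> target C f \<in> obj C"
    and ident_hom: "X \<in> obj C \<Longrightarrow> \<i> X \<in> hom C X X"
    and comp_hom: "\<lbrakk>f \<in> hom C X Y; g \<in> hom C Y Z\<rbrakk> \<Longrightarrow> g \<cdot> f \<in> hom C X Z"
    and comp_ident: "f \<in> hom C X Y \<Longrightarrow> f \<cdot> \<i> X = f"
    and ident_comp: "f \<in> hom C X Y \<Longrightarrow> \<i> Y \<cdot> f = f"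
    and comp_assoc:
      "\<lbrakk>f \<in> hom C X Y; g \<in> hom C Y Z; h \<in> hom C Z W\<rbrakk> \<Longrightarrow> (h \<cdot> g) \<cdot> f = h \<cdot> (g \<cdot> f)"

text \<open>
  The tensor product is written \<open>\<odot>\<close> on objects and \<open>\<otimes>\<close> on arrows.
\<close>

record ('o, 'a) moncat = "('o, 'a) cat" +
  tensor_obj :: "'o \<Rightarrow> 'o \<Rightarrow> 'o" (infixl "\<odot>\<index>" 70)
  tensor_arr :: "'a \<Rightarrow> 'a \<Rightarrow> 'a" (infixl "\<otimes>\<index>" 70)
  tensor_unit :: 'o ("\<one>\<index>")

locale strict_monoidal_category = category C
  for C :: "('o, 'a, 'x) moncat_scheme" (structure) +
  assumes unit_obj: "\<one> \<in> obj C"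
    and tensor_obj_closed: "\<lbrakk>X \<in> obj C; Y \<in> obj C\<rbrakk> \<Longrightarrow> X \<odot> Y \<in> obj C"
    and tensor_hom:
      "\<lbrakk>f \<in> hom C X X'; g \<in> hom C Y Y'\<rbrakk> \<Longrightarrow> f \<otimes> g \<in> hom C (X \<odot> Y) (X' \<odot> Y')"
    and tensor_ident: "\<lbrakk>X \<in> obj C; Y \<in> obj C\<rbrakk> \<Longrightarrow> \<i> X \<otimes> \<i> Y = \<i> (X \<odot> Y)"
    and tensor_comp:
      "\<lbrakk>f \<in> hom C X X'; f' \<in> hom C X' X''; g \<in> hom C Y Y'; g' \<in> hom C Y' Y''\<rbrakk>
        \<Longrightarrow> (f' \<cdot> f) \<otimes> (g' \<cdot> g) = (f' \<otimes> g') \<cdot> (f \<otimes> g)"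
    and tensor_obj_assoc:
      "\<lbrakk>X \<in> obj C; Y \<in> obj C; Z \<in> obj C\<rbrakk> \<Longrightarrow> (X \<odot> Y) \<odot> Z = X \<odot> (Y \<odot> Z)"
    and tensor_obj_unit_left: "X \<in> obj C \<Longrightarrow> \<one> \<odot> X = X"
    and tensor_obj_unit_right: "X \<in> obj C \<Longrightarrow> X \<odot> \<one> = X"
    and tensor_arr_assoc:
      "\<lbrakk>f \<in> arr C; g \<in> arr C; h \<in> arr C\<rbrakk> \<Longrightarrow> (f \<otimes> g) \<otimes> h = f \<otimes> (g \<otimes> h)"
    and tensor_arr_unit_left: "f \<in> arr C \<Longrightarrow> \<i> \<one> \<otimes> f = f"
    and tensor_arr_unit_right: "f \<in> arr C \<Longrightarrow> f \<otimes> \<i> \<one> = f"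

text \<open>
  \<open>rdual\<close>, \<open>ev\<close> and \<open>coev\<close> are the chosen right duals with their evaluations and coevaluations.
\<close>

record ('o, 'a) rautcat = "('o, 'a) moncat" +
  rdual :: "'o \<Rightarrow> 'o"
  ev :: "'o \<Rightarrow> 'a"
  coev :: "'o \<Rightarrow> 'a"

locale right_autonomous_category = strict_monoidal_category C
  for C :: "('o, 'a, 'x) rautcat_scheme" (structure) +
  assumes rdual_obj: "X \<in> obj C \<Longrightarrow> rdual C X \<in> obj C"
    and ev_hom: "X \<in> obj C \<Longrightarrow> ev C X \<in> hom C (X \<odot> rdual C X) \<one>"
    and coev_hom: "X \<in> obj C \<Longrightarrow> coev C X \<in> hom C \<one> (rdual C X \<odot> X)"
    and zigzag_obj: "X \<in> obj C \<Longrightarrow> (ev C X \<otimes> \<i> X) \<cdot> (\<i> X \<otimes> coev C X) = \<i> X"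
    and zigzag_rdual:
      "X \<in> obj C \<Longrightarrow>
        (\<i> (rdual C X) \<otimes> ev C X) \<cdot> (coev C X \<otimes> \<i> (rdual C X)) = \<i> (rdual C X)"

text \<open>
  The right dual \<open>f\<^sup>\<or> : Y\<^sup>\<or> \<rightarrow> X\<^sup>\<or>\<close> of an arrow \<open>f : X \<rightarrow> Y\<close>.
\<close>

definition rdual_arr :: "('o, 'a, 'x) rautcat_scheme \<Rightarrow> 'a \<Rightarrow> 'a" where
  "rdual_arr C f =
    (let X = source C f; Y = target C f in
      (\<i>\<^bsub>C\<^esub> (rdual C X) \<otimes>\<^bsub>C\<^esub> ev C Y)
      \<cdot>\<^bsub>C\<^esub> (\<i>\<^bsub>C\<^esub> (rdual C X) \<otimes>\<^bsub>C\<^esub> f \<otimes>\<^bsub>C\<^esub> \<i>\<^bsub>C\<^esub> (rdual C Y))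
      \<cdot>\<^bsub>C\<^esub> (coev C X \<otimes>\<^bsub>C\<^esub> \<i>\<^bsub>C\<^esub> (rdual C Y)))"

record ('o, 'a) endo =
  on_obj :: "'o \<Rightarrow> 'o"
  on_arr :: "'a \<Rightarrow> 'a"

locale endofunctor = category C
  for C :: "('o, 'a, 'x) cat_scheme" (structure) +
  fixes F :: "('o, 'a, 'y) endo_scheme"
  assumes on_obj_closed: "X \<in> obj C \<Longrightarrow> on_obj F X \<in> obj C"
    and on_arr_hom: "f \<in> hom C X Y \<Longrightarrow> on_arr F f \<in> hom C (on_obj F X) (on_obj F Y)"
    and on_arr_ident: "X \<in> obj C \<Longrightarrow> on_arr F (\<i> X) = \<i> (on_obj F X)"
    and on_arr_comp:
      "\<lbrakk>f \<in> hom C X Y; g \<in> hom C Y Z\<rbrakk> \<Longrightarrow> on_arr F (g \<cdot> f) = on_arr F g \<cdot> on_arr F f"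

definition endo_id :: "('o, 'a) endo" where
  "endo_id = \<lparr>on_obj = (\<lambda>X. X), on_arr = (\<lambda>f. f)\<rparr>"

definition endo_comp ::
  "('o, 'a, 'y) endo_scheme \<Rightarrow> ('o, 'a, 'z) endo_scheme \<Rightarrow> ('o, 'a) endo" where
  "endo_comp G F =
    \<lparr>on_obj = (\<lambda>X. on_obj G (on_obj F X)), on_arr = (\<lambda>f. on_arr G (on_arr F f))\<rparr>"

definition natural ::
  "('o, 'a, 'x) cat_scheme \<Rightarrow> ('o, 'a, 'y) endo_scheme \<Rightarrow> ('o, 'a, 'z) endo_scheme
    \<Rightarrow> ('o \<Rightarrow> 'a) \<Rightarrow> bool" where
  "natural C F G \<alpha> \<longleftrightarrow>
    (\<forall>X \<in> obj C. \<alpha> X \<in> hom C (on_obj F X) (on_obj G X)) \<and>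
    (\<forall>X Y. \<forall>f \<in> hom C X Y. \<alpha> Y \<cdot>\<^bsub>C\<^esub> on_arr F f = on_arr G f \<cdot>\<^bsub>C\<^esub> \<alpha> X)"

record ('o, 'a) mnd = "('o, 'a) endo" +
  \<mu> :: "'o \<Rightarrow> 'a"
  \<eta> :: "'o \<Rightarrow> 'a"

locale monad = endofunctor C T
  for C :: "('o, 'a, 'x) cat_scheme" (structure)
    and T :: "('o, 'a, 'y) mnd_scheme" +
  assumes mu_natural: "natural C (endo_comp T T) T (\<mu> T)"
    and eta_natural: "natural C endo_id T (\<eta> T)"
    and mu_assoc: "X \<in> obj C \<Longrightarrow> \<mu> T X \<cdot> on_arr T (\<mu> T X) = \<mu> T X \<cdot> \<mu> T (on_obj T X)"
    and mu_eta_left: "X \<in> obj C \<Longrightarrow> \<mu> T X \<cdot> \<eta> T (on_obj T X) = \<i> (on_obj T X)"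
    and mu_eta_right: "X \<in> obj C \<Longrightarrow> \<mu> T X \<cdot> on_arr T (\<eta> T X) = \<i> (on_obj T X)"

definition T_module ::
  "('o, 'a, 'x) cat_scheme \<Rightarrow> ('o, 'a, 'y) mnd_scheme \<Rightarrow> 'o \<times> 'a \<Rightarrow> bool" where
  "T_module C T = (\<lambda>(M, r).
    M \<in> obj C \<and> r \<in> hom C (on_obj T M) M \<and>
    r \<cdot>\<^bsub>C\<^esub> on_arr T r = r \<cdot>\<^bsub>C\<^esub> \<mu> T M \<and>
    r \<cdot>\<^bsub>C\<^esub> \<eta> T M = \<i>\<^bsub>C\<^esub> M)"

definition T_linear ::
  "('o, 'a, 'x) cat_scheme \<Rightarrow> ('o, 'a, 'y) mnd_scheme \<Rightarrow> 'o \<times> 'a \<Rightarrow> 'o \<times> 'a \<Rightarrow> 'a \<Rightarrow> bool" where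
  "T_linear C T = (\<lambda>(M, r) (N, s) f.
    f \<in> hom C M N \<and> f \<cdot>\<^bsub>C\<^esub> r = s \<cdot>\<^bsub>C\<^esub> on_arr T f)"

definition semisimple_monad ::
  "('o, 'a, 'x) cat_scheme \<Rightarrow> ('o, 'a, 'y) mnd_scheme \<Rightarrow> bool" where
  "semisimple_monad C T \<longleftrightarrow>
    (\<forall>M r. T_module C T (M, r) \<longrightarrow>
      (\<exists>\<sigma>. T_linear C T (M, r) (on_obj T M, \<mu> T M) \<sigma> \<and> r \<cdot>\<^bsub>C\<^esub> \<sigma> = \<i>\<^bsub>C\<^esub> M))"

definition separable_monad ::
  "('o, 'a, 'x) cat_scheme \<Rightarrow> ('o, 'a, 'y) mnd_scheme \<Rightarrow> bool" where
  "separable_monad C T \<longleftrightarrow>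
    (\<exists>\<gamma>. natural C endo_id (endo_comp T T) \<gamma> \<and>
      (\<forall>X \<in> obj C.
        on_arr T (\<mu> T X) \<cdot>\<^bsub>C\<^esub> \<gamma> (on_obj T X) = \<mu> T (on_obj T X) \<cdot>\<^bsub>C\<^esub> on_arr T (\<gamma> X) \<and>
        \<mu> T X \<cdot>\<^bsub>C\<^esub> \<gamma> X = \<eta> T X))"

record ('o, 'a) bimnd = "('o, 'a) mnd" +
  T\<^sub>2 :: "'o \<Rightarrow> 'o \<Rightarrow> 'a"
  T\<^sub>0 :: 'a

locale bimonad = strict_monoidal_category C + monad C T
  for C :: "('o, 'a, 'x) moncat_scheme" (structure)
    and T :: "('o, 'a, 'y) bimnd_scheme" +
  assumes T2_hom:
      "\<lbrakk>X \<in> obj C; Y \<in> obj C\<rbrakk>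
        \<Longrightarrow> T\<^sub>2 T X Y \<in> hom C (on_obj T (X \<odot> Y)) (on_obj T X \<odot> on_obj T Y)"
    and T2_natural:
      "\<lbrakk>f \<in> hom C X X'; g \<in> hom C Y Y'\<rbrakk>
        \<Longrightarrow> T\<^sub>2 T X' Y' \<cdot> on_arr T (f \<otimes> g) = (on_arr T f \<otimes> on_arr T g) \<cdot> T\<^sub>2 T X Y"
    and T0_hom: "T\<^sub>0 T \<in> hom C (on_obj T \<one>) \<one>"
    and T2_coassoc:
      "\<lbrakk>X \<in> obj C; Y \<in> obj C; Z \<in> obj C\<rbrakk>
        \<Longrightarrow> (\<i> (on_obj T X) \<otimes> T\<^sub>2 T Y Z) \<cdot> T\<^sub>2 T X (Y \<odot> Z)
          = (T\<^sub>2 T X Y \<otimes> \<i> (on_obj T Z)) \<cdot> T\<^sub>2 T (X \<odot> Y) Z"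
    and T2_counit_right:
      "X \<in> obj C \<Longrightarrow> (\<i> (on_obj T X) \<otimes> T\<^sub>0 T) \<cdot> T\<^sub>2 T X \<one> = \<i> (on_obj T X)"
    and T2_counit_left:
      "X \<in> obj C \<Longrightarrow> (T\<^sub>0 T \<otimes> \<i> (on_obj T X)) \<cdot> T\<^sub>2 T \<one> X = \<i> (on_obj T X)"
    and T2_mu:
      "\<lbrakk>X \<in> obj C; Y \<in> obj C\<rbrakk>
        \<Longrightarrow> T\<^sub>2 T X Y \<cdot> \<mu> T (X \<odot> Y)
          = (\<mu> T X \<otimes> \<mu> T Y) \<cdot> T\<^sub>2 T (on_obj T X) (on_obj T Y) \<cdot> on_arr T (T\<^sub>2 T X Y)"
    and T0_mu: "T\<^sub>0 T \<cdot> \<mu> T \<one> = T\<^sub>0 T \<cdot> on_arr T (T\<^sub>0 T)"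
    and T2_eta: "\<lbrakk>X \<in> obj C; Y \<in> obj C\<rbrakk> \<Longrightarrow> T\<^sub>2 T X Y \<cdot> \<eta> T (X \<odot> Y) = \<eta> T X \<otimes> \<eta> T Y"
    and T0_eta: "T\<^sub>0 T \<cdot> \<eta> T \<one> = \<i> \<one>"

definition cointegral ::
  "('o, 'a, 'x) moncat_scheme \<Rightarrow> ('o, 'a, 'y) bimnd_scheme \<Rightarrow> 'a \<Rightarrow> bool" where
  "cointegral C T \<Lambda> \<longleftrightarrow>
    \<Lambda> \<in> hom C \<one>\<^bsub>C\<^esub> (on_obj T \<one>\<^bsub>C\<^esub>) \<and>
    \<mu> T \<one>\<^bsub>C\<^esub> \<cdot>\<^bsub>C\<^esub> on_arr T \<Lambda> = \<Lambda> \<cdot>\<^bsub>C\<^esub> T\<^sub>0 T"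

text \<open>
  A right antipode \<open>s X : T(T(X)\<^sup>\<or>) \<rightarrow> X\<^sup>\<or>\<close>.  Both sides are contravariant in \<open>X\<close>, which fixes the
  direction of the naturality squares.
\<close>

definition right_antipode ::
  "('o, 'a, 'x) rautcat_scheme \<Rightarrow> ('o, 'a, 'y) bimnd_scheme \<Rightarrow> ('o \<Rightarrow> 'a) \<Rightarrow> bool" where
  "right_antipode C T s \<longleftrightarrow>
    (\<forall>X \<in> obj C. s X \<in> hom C (on_obj T (rdual C (on_obj T X))) (rdual C X)) \<and>
    (\<forall>X Y. \<forall>f \<in> hom C X Y.
      s X \<cdot>\<^bsub>C\<^esub> on_arr T (rdual_arr C (on_arr T f)) = rdual_arr C f \<cdot>\<^bsub>C\<^esub> s Y) \<and>
    (\<forall>X \<in> obj C.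
      T\<^sub>0 T \<cdot>\<^bsub>C\<^esub> on_arr T (ev C X) \<cdot>\<^bsub>C\<^esub> on_arr T (\<i>\<^bsub>C\<^esub> X \<otimes>\<^bsub>C\<^esub> rdual_arr C (\<eta> T X))
      = ev C (on_obj T X)
        \<cdot>\<^bsub>C\<^esub> (\<i>\<^bsub>C\<^esub> (on_obj T X) \<otimes>\<^bsub>C\<^esub> (s (on_obj T X) \<cdot>\<^bsub>C\<^esub> on_arr T (rdual_arr C (\<mu> T X))))
        \<cdot>\<^bsub>C\<^esub> T\<^sub>2 T X (rdual C (on_obj T X))) \<and>
    (\<forall>X \<in> obj C.
      (\<i>\<^bsub>C\<^esub> (rdual C X) \<otimes>\<^bsub>C\<^esub> \<eta> T X) \<cdot>\<^bsub>C\<^esub> coev C X \<cdot>\<^bsub>C\<^esub> T\<^sub>0 T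
      = (s X \<otimes>\<^bsub>C\<^esub> \<mu> T X)
        \<cdot>\<^bsub>C\<^esub> T\<^sub>2 T (rdual C (on_obj T X)) (on_obj T X)
        \<cdot>\<^bsub>C\<^esub> on_arr T (coev C (on_obj T X)))"

definition right_hopf_monad ::
  "('o, 'a, 'x) rautcat_scheme \<Rightarrow> ('o, 'a, 'y) bimnd_scheme \<Rightarrow> bool" where
  "right_hopf_monad C T \<longleftrightarrow>
    right_autonomous_category C \<and> bimonad C T \<and> (\<exists>s. right_antipode C T s)"

end

theory Submission
  imports Defs
begin

text \<open>
  A normalised cointegral is the same thing as a \<open>T\<close>-linear section of the action \<open>T\<^sub>0\<close> of the
  unit module.  To transport it to an arbitrary module \<open>(M, r)\<close>, consider the \<open>T\<close>-linear morphism
  \<open>H = (r \<otimes> \<i>) T\<^sub>2(M, \<one>) : T M \<rightarrow> M \<otimes> T \<one>\<close>, which is natural in the module and satisfies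
  \<open>(\<i> \<otimes> T\<^sub>0) H = r\<close>.  The antipode turns \<open>M\<^sup>\<or>\<close> into an object with an action for which
  evaluation and coevaluation are linear, and this makes \<open>H\<close> invertible.  Then
  \<open>H\<^sup>-\<^sup>1 (\<i> \<otimes> \<Lambda>)\<close> is a linear section of \<open>r\<close>, natural in \<open>(M, r)\<close>, and composing it for free
  modules with the unit of \<open>T\<close> gives \<open>\<gamma>\<close>.
\<close>

section \<open>Typing of arrows by source and target\<close>

context category
begin

lemma in_hom_iff: "f \<in> hom C X Y \<longleftrightarrow> f \<in> arr C \<and> source C f = X \<and> target C f = Y"
  by (simp add: hom_def)

declare source_obj [simp] target_obj [simp]

lemma in_homD:
  assumes "f \<in> hom C X Y"
  shows "f \<in> arr C" "source C f = X" "target C f = Y" "X \<in> obj C" "Y \<in> obj C"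
  using assms by (auto simp: in_hom_iff)

lemma ident_typing [simp]:
  assumes "X \<in> obj C"
  shows "\<i> X \<in> arr C" "source C (\<i> X) = X" "target C (\<i> X) = X"
  using ident_hom[OF assms] by (auto simp: in_hom_iff)

text \<open>In \<open>hom\<close> form the middle object would be an extra variable in the premises.
  With sources and targets the simplifier decides composability by computing both.\<close>

lemma comp_typing [simp]:
  assumes "f \<in> arr C" "g \<in> arr C" "target C f = source C g"
  shows "g \<cdot> f \<in> arr C" "source C (g \<cdot> f) = source C f" "target C (g \<cdot> f) = target C g"
  using comp_hom[of f "source C f" "source C g" g "target C g"] assms by (auto simp: in_hom_iff)

lemma comp_ident_arr [simp]: "\<lbrakk>f \<in> arr C; source C f = X\<rbrakk> \<Longrightarrow> f \<cdot> \<i> X = f"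
  and ident_comp_arr [simp]: "\<lbrakk>f \<in> arr C; target C f = Y\<rbrakk> \<Longrightarrow> \<i> Y \<cdot> f = f"
  by (rule comp_ident ident_comp; simp add: in_hom_iff)+

text \<open>Composites are normalised to nest on the right; calculations below therefore bracket a
  subcomposite explicitly before rewriting it.\<close>

lemma comp_assoc_arr [simp]:
  "\<lbrakk>f \<in> arr C; g \<in> arr C; h \<in> arr C; target C f = source C g; target C g = source C h\<rbrakk>
    \<Longrightarrow> (h \<cdot> g) \<cdot> f = h \<cdot> (g \<cdot> f)"
  by (rule comp_assoc) (auto simp: in_hom_iff)

end

section \<open>Calculus in a strict monoidal category\<close>

context strict_monoidal_category
begin

lemma tensor_obj_simps [simp]:
  "\<one> \<in> obj C"
  "\<lbrakk>X \<in> obj C; Y \<in> obj C\<rbrakk> \<Longrightarrow> X \<odot> Y \<in> obj C"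
  "\<lbrakk>X \<in> obj C; Y \<in> obj C; Z \<in> obj C\<rbrakk> \<Longrightarrow> (X \<odot> Y) \<odot> Z = X \<odot> (Y \<odot> Z)"
  "X \<in> obj C \<Longrightarrow> \<one> \<odot> X = X"
  "X \<in> obj C \<Longrightarrow> X \<odot> \<one> = X"
  by (simp_all add: unit_obj tensor_obj_closed tensor_obj_assoc tensor_obj_unit_left
      tensor_obj_unit_right)

lemma tensor_typing [simp]:
  assumes "f \<in> arr C" "g \<in> arr C"
  shows "f \<otimes> g \<in> arr C" "source C (f \<otimes> g) = source C f \<odot> source C g"
    "target C (f \<otimes> g) = target C f \<odot> target C g"
  using tensor_hom[of f "source C f" "target C f" g "source C g" "target C g"] assms
  by (auto simp: in_hom_iff)

lemma tensor_arr_simps [simp]: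
  "\<lbrakk>f \<in> arr C; g \<in> arr C; h \<in> arr C\<rbrakk> \<Longrightarrow> (f \<otimes> g) \<otimes> h = f \<otimes> (g \<otimes> h)"
  "f \<in> arr C \<Longrightarrow> \<i> \<one> \<otimes> f = f"
  "f \<in> arr C \<Longrightarrow> f \<otimes> \<i> \<one> = f"
  "\<lbrakk>X \<in> obj C; Y \<in> obj C\<rbrakk> \<Longrightarrow> \<i> X \<otimes> \<i> Y = \<i> (X \<odot> Y)"
  by (simp_all add: tensor_arr_assoc tensor_arr_unit_left tensor_arr_unit_right tensor_ident)

lemma interchange:
  "\<lbrakk>f \<in> arr C; f' \<in> arr C; g \<in> arr C; g' \<in> arr C;
    target C f = source C f'; target C g = source C g'\<rbrakk>
    \<Longrightarrow> (f' \<otimes> g') \<cdot> (f \<otimes> g) = (f' \<cdot> f) \<otimes> (g' \<cdot> g)"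
  using tensor_comp[of f "source C f" "target C f" f' "target C f'" g "source C g" "target C g"
      g' "target C g'"]
  by (simp add: in_hom_iff)

text \<open>Tensors of arrows also nest on the right, so two leading identities do not form an
  instance of \<open>tensor_ident\<close>; this rule merges them.\<close>

lemma tensor_ident_ident [simp]:
  "\<lbrakk>X \<in> obj C; Y \<in> obj C; f \<in> arr C\<rbrakk> \<Longrightarrow> \<i> X \<otimes> (\<i> Y \<otimes> f) = \<i> (X \<odot> Y) \<otimes> f"
  by (metis tensor_arr_assoc tensor_ident ident_typing(1))

text \<open>Splits along an identity factor, against the direction of \<open>interchange\<close>.
  Each calculation step uses only one of the two orientations.\<close>

lemma whisker:
  assumes "f \<in> arr C" "g \<in> arr C" "target C f = source C g" "X \<in> obj C"
  shows "\<i> X \<otimes> (g \<cdot> f) = (\<i> X \<otimes> g) \<cdot> (\<i> X \<otimes> f)"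
    and "(g \<cdot> f) \<otimes> \<i> X = (g \<otimes> \<i> X) \<cdot> (f \<otimes> \<i> X)"
  using assms by (simp_all add: interchange)

text \<open>Arrows on different tensor factors commute, both sides being
  \<open>f \<otimes> g\<close>.\<close>

lemma slide:
  assumes "f \<in> arr C" "g \<in> arr C"
  shows "(f \<otimes> \<i> (target C g)) \<cdot> (\<i> (source C f) \<otimes> g)
    = (\<i> (target C f) \<otimes> g) \<cdot> (f \<otimes> \<i> (source C g))"
  using assms by (simp add: interchange)

end

section \<open>Right duals and transposed arrows\<close>

context right_autonomous_category
begin

lemma duality_typing [simp]:
  assumes "X \<in> obj C"
  shows "rdual C X \<in> obj C"
    "ev C X \<in> arr C" "source C (ev C X) = X \<odot> rdual C X" "target C (ev C X) = \<one>"
    "coev C X \<in> arr C" "source C (coev C X) = \<one>" "target C (coev C X) = rdual C X \<odot> X"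
  using rdual_obj[OF assms] ev_hom[OF assms] coev_hom[OF assms] by (auto simp: in_hom_iff)

lemma rdual_arr_typing [simp]:
  assumes "f \<in> arr C"
  shows "rdual_arr C f \<in> arr C" "source C (rdual_arr C f) = rdual C (target C f)"
    "target C (rdual_arr C f) = rdual C (source C f)"
  using assms by (simp_all add: rdual_arr_def Let_def)

text \<open>With the transpose unfolded, \<open>ev C X\<close> slides past the rest and exposes a
  zigzag on \<open>X\<close>.\<close>

lemma ev_rdual_arr:
  assumes f: "f \<in> hom C X Y"
  shows "ev C X \<cdot> (\<i> X \<otimes> rdual_arr C f) = ev C Y \<cdot> (f \<otimes> \<i> (rdual C Y))"
proof -
  have [simp]: "f \<in> arr C" "source C f = X" "target C f = Y" "X \<in> obj C" "Y \<in> obj C"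
    using in_homD[OF f] by auto
  let ?X = "rdual C X" and ?Y = "rdual C Y"
  let ?g = "ev C Y \<cdot> (f \<otimes> \<i> ?Y)"
  have d: "rdual_arr C f = (\<i> ?X \<otimes> ?g) \<cdot> (coev C X \<otimes> \<i> ?Y)"
    by (simp add: rdual_arr_def Let_def whisker)
  have "ev C X \<cdot> (\<i> X \<otimes> rdual_arr C f)
      = (ev C X \<cdot> (\<i> (X \<odot> ?X) \<otimes> ?g)) \<cdot> (\<i> X \<otimes> (coev C X \<otimes> \<i> ?Y))"
    by (simp add: d whisker)
  also have "ev C X \<cdot> (\<i> (X \<odot> ?X) \<otimes> ?g) = ?g \<cdot> (ev C X \<otimes> \<i> (X \<odot> ?Y))"
    using slide[of "ev C X" ?g] by simp
  also have "\<dots> \<cdot> (\<i> X \<otimes> (coev C X \<otimes> \<i> ?Y))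
      = ?g \<cdot> (((ev C X \<otimes> \<i> X) \<cdot> (\<i> X \<otimes> coev C X)) \<otimes> \<i> ?Y)"
    by (simp add: whisker)
  also have "\<dots> = ?g"
    by (simp add: zigzag_obj)
  finally show ?thesis .
qed

text \<open>Mirror image of the previous argument: \<open>coev C Y\<close> slides past the rest and
  the zigzag appears on \<open>Y\<close>.\<close>

lemma coev_rdual_arr:
  assumes f: "f \<in> hom C X Y"
  shows "(rdual_arr C f \<otimes> \<i> Y) \<cdot> coev C Y = (\<i> (rdual C X) \<otimes> f) \<cdot> coev C X"
proof -
  have [simp]: "f \<in> arr C" "source C f = X" "target C f = Y" "X \<in> obj C" "Y \<in> obj C"
    using in_homD[OF f] by auto
  let ?X = "rdual C X" and ?Y = "rdual C Y"
  let ?h = "(\<i> ?X \<otimes> f) \<cdot> coev C X"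
  have d: "rdual_arr C f = (\<i> ?X \<otimes> ev C Y) \<cdot> (?h \<otimes> \<i> ?Y)"
    by (simp add: rdual_arr_def Let_def whisker)
  have "(rdual_arr C f \<otimes> \<i> Y) \<cdot> coev C Y
      = (\<i> ?X \<otimes> (ev C Y \<otimes> \<i> Y)) \<cdot> ((?h \<otimes> \<i> (?Y \<odot> Y)) \<cdot> coev C Y)"
    by (simp add: d whisker)
  also have "(?h \<otimes> \<i> (?Y \<odot> Y)) \<cdot> coev C Y = (\<i> (?X \<odot> Y) \<otimes> coev C Y) \<cdot> ?h"
    using slide[of ?h "coev C Y"] by simp
  also have "(\<i> ?X \<otimes> (ev C Y \<otimes> \<i> Y)) \<cdot> \<dots>
      = (\<i> ?X \<otimes> ((ev C Y \<otimes> \<i> Y) \<cdot> (\<i> Y \<otimes> coev C Y))) \<cdot> ?h"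
    by (simp add: whisker)
  also have "\<dots> = ?h"
    by (simp add: zigzag_obj)
  finally show ?thesis .
qed

text \<open>Transposes are unique: by \<open>zigzag_rdual\<close>, \<open>h\<close> can be recovered
  from \<open>ev C X \<cdot> (\<i> X \<otimes> h)\<close>.\<close>

lemma rdual_arr_eqI:
  assumes f: "f \<in> hom C X Y" and h: "h \<in> hom C (rdual C Y) (rdual C X)"
    and eq: "ev C X \<cdot> (\<i> X \<otimes> h) = ev C Y \<cdot> (f \<otimes> \<i> (rdual C Y))"
  shows "h = rdual_arr C f"
proof -
  have [simp]: "f \<in> arr C" "source C f = X" "target C f = Y" "X \<in> obj C" "Y \<in> obj C"
    "h \<in> arr C" "source C h = rdual C Y" "target C h = rdual C X"
    using in_homD[OF f] in_homD[OF h] by auto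
  let ?X = "rdual C X" and ?Y = "rdual C Y"
  have "h = ((\<i> ?X \<otimes> ev C X) \<cdot> (coev C X \<otimes> \<i> ?X)) \<cdot> h"
    by (simp add: zigzag_rdual del: comp_assoc_arr)
  also have "\<dots> = (\<i> ?X \<otimes> ev C X) \<cdot> ((coev C X \<otimes> \<i> ?X) \<cdot> h)"
    by simp
  also have "(coev C X \<otimes> \<i> ?X) \<cdot> h = (\<i> (?X \<odot> X) \<otimes> h) \<cdot> (coev C X \<otimes> \<i> ?Y)"
    using slide[of "coev C X" h] by simp
  also have "(\<i> ?X \<otimes> ev C X) \<cdot> \<dots>
      = (\<i> ?X \<otimes> (ev C X \<cdot> (\<i> X \<otimes> h))) \<cdot> (coev C X \<otimes> \<i> ?Y)"
    by (simp add: whisker)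
  also have "\<dots> = rdual_arr C f"
    by (simp add: eq rdual_arr_def Let_def whisker)
  finally show ?thesis .
qed

text \<open>By uniqueness of transposes it suffices to move the two factors across the evaluations,
  one after the other.\<close>

lemma rdual_arr_comp:
  assumes f: "f \<in> hom C X Y" and g: "g \<in> hom C Y Z"
  shows "rdual_arr C (g \<cdot> f) = rdual_arr C f \<cdot> rdual_arr C g"
proof (rule sym, rule rdual_arr_eqI)
  have [simp]: "f \<in> arr C" "source C f = X" "target C f = Y" "X \<in> obj C" "Y \<in> obj C"
    "g \<in> arr C" "source C g = Y" "target C g = Z" "Z \<in> obj C"
    using in_homD[OF f] in_homD[OF g] by auto
  let ?X = "rdual C X" and ?Y = "rdual C Y" and ?Z = "rdual C Z"
  show "g \<cdot> f \<in> hom C X Z" and "rdual_arr C f \<cdot> rdual_arr C g \<in> hom C ?Z ?X"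
    by (simp_all add: in_hom_iff)
  have "ev C X \<cdot> (\<i> X \<otimes> (rdual_arr C f \<cdot> rdual_arr C g))
      = (ev C X \<cdot> (\<i> X \<otimes> rdual_arr C f)) \<cdot> (\<i> X \<otimes> rdual_arr C g)"
    by (simp add: interchange)
  also have "\<dots> = ev C Y \<cdot> ((f \<otimes> \<i> ?Y) \<cdot> (\<i> X \<otimes> rdual_arr C g))"
    by (simp add: ev_rdual_arr[OF f])
  also have "\<dots> = (ev C Y \<cdot> (\<i> Y \<otimes> rdual_arr C g)) \<cdot> (f \<otimes> \<i> ?Z)"
    using slide[of f "rdual_arr C g"] by simp
  also have "\<dots> = ev C Z \<cdot> ((g \<cdot> f) \<otimes> \<i> ?Z)"
    by (simp add: ev_rdual_arr[OF g] interchange)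
  finally show "ev C X \<cdot> (\<i> X \<otimes> (rdual_arr C f \<cdot> rdual_arr C g))
      = ev C Z \<cdot> ((g \<cdot> f) \<otimes> \<i> ?Z)" .
qed

lemma rdual_arr_ident [simp]:
  assumes "X \<in> obj C"
  shows "rdual_arr C (\<i> X) = \<i> (rdual C X)"
  by (rule sym, rule rdual_arr_eqI) (use assms in \<open>auto simp: in_hom_iff\<close>)

end

section \<open>Endofunctors, monads, modules and separability\<close>

context endofunctor
begin

lemma on_arr_typing [simp]:
  "X \<in> obj C \<Longrightarrow> on_obj F X \<in> obj C"
  "f \<in> arr C \<Longrightarrow> on_arr F f \<in> arr C"
  "f \<in> arr C \<Longrightarrow> source C (on_arr F f) = on_obj F (source C f)"
  "f \<in> arr C \<Longrightarrow> target C (on_arr F f) = on_obj F (target C f)"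
  using on_obj_closed on_arr_hom[of f "source C f" "target C f"] by (auto simp: in_hom_iff)

declare on_arr_ident [simp]

lemma on_arr_comp_arr:
  "\<lbrakk>f \<in> arr C; g \<in> arr C; target C f = source C g\<rbrakk>
    \<Longrightarrow> on_arr F (g \<cdot> f) = on_arr F g \<cdot> on_arr F f"
  by (rule on_arr_comp) (auto simp: in_hom_iff)

end

context monad
begin

lemma mu_eta_typing [simp]:
  assumes "X \<in> obj C"
  shows "\<mu> T X \<in> arr C" "source C (\<mu> T X) = on_obj T (on_obj T X)"
    "target C (\<mu> T X) = on_obj T X"
    "\<eta> T X \<in> arr C" "source C (\<eta> T X) = X" "target C (\<eta> T X) = on_obj T X"
  using mu_natural eta_natural assms
  by (auto simp: natural_def in_hom_iff endo_comp_def endo_id_def)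

lemma mu_nat:
  "f \<in> hom C X Y \<Longrightarrow> \<mu> T Y \<cdot> on_arr T (on_arr T f) = on_arr T f \<cdot> \<mu> T X"
  using mu_natural by (simp add: natural_def endo_comp_def)

lemma eta_nat: "f \<in> hom C X Y \<Longrightarrow> \<eta> T Y \<cdot> f = on_arr T f \<cdot> \<eta> T X"
  using eta_natural by (simp add: natural_def endo_id_def)

lemma T_moduleD:
  assumes "T_module C T (M, r)"
  shows "M \<in> obj C" "r \<in> arr C" "source C r = on_obj T M" "target C r = M"
    "r \<cdot> on_arr T r = r \<cdot> \<mu> T M" "r \<cdot> \<eta> T M = \<i> M"
  using assms by (auto simp: T_module_def in_hom_iff)

lemma T_linearD:
  assumes "T_linear C T (M, r) (N, t) f"
  shows "f \<in> arr C" "source C f = M" "target C f = N" "f \<cdot> r = t \<cdot> on_arr T f"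
  using assms by (auto simp: T_linear_def in_hom_iff)

lemma free_module: "X \<in> obj C \<Longrightarrow> T_module C T (on_obj T X, \<mu> T X)"
  by (simp add: T_module_def in_hom_iff mu_assoc mu_eta_left)

lemma separable_imp_semisimple:
  assumes "separable_monad C T"
  shows "semisimple_monad C T"
proof -
  obtain \<gamma> where nat: "natural C endo_id (endo_comp T T) \<gamma>"
    and bil: "\<And>X. X \<in> obj C \<Longrightarrow>
      on_arr T (\<mu> T X) \<cdot> \<gamma> (on_obj T X) = \<mu> T (on_obj T X) \<cdot> on_arr T (\<gamma> X)"
    and sec: "\<And>X. X \<in> obj C \<Longrightarrow> \<mu> T X \<cdot> \<gamma> X = \<eta> T X"
    using assms by (auto simp: separable_monad_def)
  have \<gamma>_typing [simp]: "\<gamma> X \<in> arr C" "source C (\<gamma> X) = X"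
    "target C (\<gamma> X) = on_obj T (on_obj T X)" if "X \<in> obj C" for X
    using nat that by (auto simp: natural_def in_hom_iff endo_comp_def endo_id_def)
  have \<gamma>_nat: "\<gamma> Y \<cdot> f = on_arr T (on_arr T f) \<cdot> \<gamma> X" if "f \<in> hom C X Y" for f X Y
    using nat that by (simp add: natural_def endo_comp_def endo_id_def)
  show ?thesis
    unfolding semisimple_monad_def
  proof (intro allI impI exI conjI)
    fix M r assume M: "T_module C T (M, r)"
    note [simp] = T_moduleD(1-4)[OF M]
    note act = T_moduleD(5)[OF M] and unit = T_moduleD(6)[OF M]
    \<comment> \<open>\<open>\<gamma> M\<close> lands in T(T(M)), and the action collapses the inner
      copy. The section law comes from \<open>sec\<close>, linearity from
      \<open>bil\<close>.\<close>
    let ?\<sigma> = "on_arr T r \<cdot> \<gamma> M"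
    have "r \<cdot> ?\<sigma> = (r \<cdot> on_arr T r) \<cdot> \<gamma> M"
      by simp
    also have "\<dots> = r \<cdot> (\<mu> T M \<cdot> \<gamma> M)"
      by (simp add: act)
    finally show "r \<cdot> ?\<sigma> = \<i> M"
      by (simp add: sec unit)
    have "\<mu> T M \<cdot> on_arr T ?\<sigma> = (\<mu> T M \<cdot> on_arr T (on_arr T r)) \<cdot> on_arr T (\<gamma> M)"
      by (simp add: on_arr_comp_arr)
    also have "\<dots> = on_arr T r \<cdot> (\<mu> T (on_obj T M) \<cdot> on_arr T (\<gamma> M))"
      by (simp add: mu_nat[of r "on_obj T M" M] in_hom_iff)
    also have "\<dots> = on_arr T (r \<cdot> \<mu> T M) \<cdot> \<gamma> (on_obj T M)"
      by (simp add: on_arr_comp_arr flip: bil)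
    \<comment> \<open>Trading \<open>r \<cdot> \<mu> T M\<close> for
      \<open>r \<cdot> on_arr T r\<close> makes naturality of \<open>\<gamma>\<close> at
      \<open>r\<close> applicable.\<close>
    also have "\<dots> = on_arr T r \<cdot> (on_arr T (on_arr T r) \<cdot> \<gamma> (on_obj T M))"
      by (simp add: on_arr_comp_arr flip: act)
    also have "\<dots> = ?\<sigma> \<cdot> r"
      by (simp add: \<gamma>_nat[of r "on_obj T M" M] in_hom_iff)
    finally show "T_linear C T (M, r) (on_obj T M, \<mu> T M) ?\<sigma>"
      by (simp add: T_linear_def in_hom_iff)
  qed
qed

text \<open>A linear map out of a free module is determined by its restriction along the unit, so
  \<open>\<gamma> X\<close> is taken to be the restriction of the section for the free module on
  \<open>X\<close>. Naturality in the module gives naturality of \<open>\<gamma>\<close> and half of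
  its compatibility with \<open>\<mu>\<close>; linearity gives the other half.\<close>

lemma separableI:
  assumes lin: "\<And>M r. T_module C T (M, r) \<Longrightarrow>
      T_linear C T (M, r) (on_obj T M, \<mu> T M) (\<sigma> M r)"
    and sec: "\<And>M r. T_module C T (M, r) \<Longrightarrow> r \<cdot> \<sigma> M r = \<i> M"
    and nat: "\<And>M r N t f. \<lbrakk>T_module C T (M, r); T_module C T (N, t);
      T_linear C T (M, r) (N, t) f\<rbrakk> \<Longrightarrow> \<sigma> N t \<cdot> f = on_arr T f \<cdot> \<sigma> M r"
  shows "separable_monad C T"
proof -
  define \<sigma>' where "\<sigma>' X = \<sigma> (on_obj T X) (\<mu> T X)" for X
  define \<gamma> where "\<gamma> X = \<sigma>' X \<cdot> \<eta> T X" for X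
  have \<sigma>'_typing [simp]: "\<sigma>' X \<in> arr C" "source C (\<sigma>' X) = on_obj T X"
      "target C (\<sigma>' X) = on_obj T (on_obj T X)"
    and \<sigma>'_lin: "\<sigma>' X \<cdot> \<mu> T X = \<mu> T (on_obj T X) \<cdot> on_arr T (\<sigma>' X)" if "X \<in> obj C" for X
    using T_linearD[OF lin[OF free_module[OF that]]] by (auto simp: \<sigma>'_def)
  have "natural C endo_id (endo_comp T T) \<gamma>"
    unfolding natural_def
  proof (intro conjI ballI allI)
    fix X assume "X \<in> obj C"
    then show "\<gamma> X \<in> hom C (on_obj endo_id X) (on_obj (endo_comp T T) X)"
      by (simp add: in_hom_iff endo_id_def endo_comp_def \<gamma>_def)
  next
    fix X Y f assume f: "f \<in> hom C X Y"
    note [simp] = in_homD[OF f]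
    have "T_linear C T (on_obj T X, \<mu> T X) (on_obj T Y, \<mu> T Y) (on_arr T f)"
      by (simp add: T_linear_def in_hom_iff mu_nat[OF f])
    then have \<sigma>'_nat: "\<sigma>' Y \<cdot> on_arr T f = on_arr T (on_arr T f) \<cdot> \<sigma>' X"
      by (simp add: \<sigma>'_def nat free_module)
    have "\<gamma> Y \<cdot> f = (\<sigma>' Y \<cdot> on_arr T f) \<cdot> \<eta> T X"
      by (simp add: \<gamma>_def eta_nat[OF f])
    also have "\<dots> = on_arr T (on_arr T f) \<cdot> \<gamma> X"
      by (simp add: \<sigma>'_nat \<gamma>_def)
    finally show "\<gamma> Y \<cdot> on_arr endo_id f = on_arr (endo_comp T T) f \<cdot> \<gamma> X"
      by (simp add: endo_id_def endo_comp_def)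
  qed
  moreover have "on_arr T (\<mu> T X) \<cdot> \<gamma> (on_obj T X) = \<mu> T (on_obj T X) \<cdot> on_arr T (\<gamma> X)"
    if [simp]: "X \<in> obj C" for X
  proof -
    \<comment> \<open>\<open>\<mu> T X\<close> is itself linear between free modules, so the
      sections are natural along it. Both sides of the goal then reduce to
      \<open>\<sigma>' X\<close>.\<close>
    have "T_linear C T (on_obj T (on_obj T X), \<mu> T (on_obj T X)) (on_obj T X, \<mu> T X) (\<mu> T X)"
      by (simp add: T_linear_def in_hom_iff mu_assoc)
    from nat[OF free_module free_module this]
    have \<mu>_nat: "on_arr T (\<mu> T X) \<cdot> \<sigma>' (on_obj T X) = \<sigma>' X \<cdot> \<mu> T X"
      by (simp add: \<sigma>'_def)
    have "on_arr T (\<mu> T X) \<cdot> \<gamma> (on_obj T X)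
        = (on_arr T (\<mu> T X) \<cdot> \<sigma>' (on_obj T X)) \<cdot> \<eta> T (on_obj T X)"
      by (simp add: \<gamma>_def)
    also have "\<dots> = \<sigma>' X"
      by (simp add: \<mu>_nat mu_eta_left)
    also have "\<dots> = (\<sigma>' X \<cdot> \<mu> T X) \<cdot> on_arr T (\<eta> T X)"
      by (simp add: mu_eta_right)
    also have "\<dots> = \<mu> T (on_obj T X) \<cdot> on_arr T (\<gamma> X)"
      by (simp add: \<sigma>'_lin \<gamma>_def on_arr_comp_arr)
    finally show ?thesis .
  qed
  moreover have "\<mu> T X \<cdot> \<gamma> X = \<eta> T X" if [simp]: "X \<in> obj C" for X
  proof -
    have "\<mu> T X \<cdot> \<gamma> X = (\<mu> T X \<cdot> \<sigma>' X) \<cdot> \<eta> T X"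
      by (simp add: \<gamma>_def)
    then show ?thesis
      by (simp add: \<sigma>'_def sec free_module)
  qed
  ultimately show ?thesis
    by (auto simp: separable_monad_def)
qed

end


section \<open>Bimonads, cointegrals and the fusion morphism\<close>

context bimonad
begin

lemma T2_typing [simp]:
  assumes "X \<in> obj C" "Y \<in> obj C"
  shows "T\<^sub>2 T X Y \<in> arr C" "source C (T\<^sub>2 T X Y) = on_obj T (X \<odot> Y)"
    "target C (T\<^sub>2 T X Y) = on_obj T X \<odot> on_obj T Y"
  using T2_hom[OF assms] by (auto simp: in_hom_iff)

lemma T0_typing [simp]:
  "T\<^sub>0 T \<in> arr C" "source C (T\<^sub>0 T) = on_obj T \<one>" "target C (T\<^sub>0 T) = \<one>"
  using T0_hom by (auto simp: in_hom_iff)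

text \<open>The equational side conditions let the simplifier find \<open>X\<close> and
  \<open>Y\<close> from \<open>f\<close> and \<open>g\<close>.\<close>

lemma T2_nat:
  "\<lbrakk>f \<in> arr C; g \<in> arr C; source C f = X; source C g = Y; target C f = X'; target C g = Y'\<rbrakk>
    \<Longrightarrow> T\<^sub>2 T X' Y' \<cdot> on_arr T (f \<otimes> g) = (on_arr T f \<otimes> on_arr T g) \<cdot> T\<^sub>2 T X Y"
  by (rule T2_natural) (simp_all add: in_hom_iff)

lemma unit_module: "T_module C T (\<one>, T\<^sub>0 T)"
  by (simp add: T_module_def in_hom_iff T0_mu T0_eta)

text \<open>The unit module suffices: linearity of a section of its action
  \<open>T\<^sub>0 T\<close> is exactly the cointegral equation.\<close>

lemma semisimple_imp_cointegral:
  assumes "semisimple_monad C T"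
  shows "\<exists>\<Lambda>. cointegral C T \<Lambda> \<and> T\<^sub>0 T \<cdot> \<Lambda> = \<i> \<one>"
proof -
  obtain \<Lambda> where lin: "T_linear C T (\<one>, T\<^sub>0 T) (on_obj T \<one>, \<mu> T \<one>) \<Lambda>"
    and sec: "T\<^sub>0 T \<cdot> \<Lambda> = \<i> \<one>"
    using assms unit_module by (auto simp: semisimple_monad_def)
  from lin have "cointegral C T \<Lambda>"
    by (simp add: T_linear_def cointegral_def)
  with sec show ?thesis by blast
qed

text \<open>At a free module \<open>(on_obj T X, \<mu> T X)\<close> this is the right fusion
  operator of the bimonad with second argument \<open>\<one>\<close>. By strictness
  \<open>M \<odot> \<one>\<close> is \<open>M\<close>, so the source is T(M).\<close>

definition fusion :: "'o \<Rightarrow> 'a \<Rightarrow> 'a" where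
  "fusion M r = (r \<otimes> \<i> (on_obj T \<one>)) \<cdot> T\<^sub>2 T M \<one>"

lemma fusion_typing [simp]:
  assumes "T_module C T (M, r)"
  shows "fusion M r \<in> arr C" "source C (fusion M r) = on_obj T M"
    "target C (fusion M r) = M \<odot> on_obj T \<one>"
  using T_moduleD[OF assms] by (simp_all add: fusion_def)

text \<open>The target is the tensor product of \<open>(M, r)\<close> with the free module on
  \<open>\<one>\<close>, whose action is \<open>r \<otimes> \<mu> T \<one>\<close> after
  \<open>T\<^sub>2\<close>. Linearity rests on \<open>T2_mu\<close> and associativity of
  \<open>r\<close>.\<close>

lemma fusion_linear:
  assumes M: "T_module C T (M, r)"
  shows "fusion M r \<cdot> \<mu> T M
    = (r \<otimes> \<mu> T \<one>) \<cdot> (T\<^sub>2 T M (on_obj T \<one>) \<cdot> on_arr T (fusion M r))"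
proof -
  note [simp] = T_moduleD(1-4)[OF M]
  let ?I = "on_obj T \<one>"
  \<comment> \<open>\<open>M\<close> is written \<open>M \<odot> \<one>\<close> under
    \<open>\<mu> T\<close> to match \<open>T2_mu\<close>; the next step switches the right unit law
    off for the same reason.\<close>
  have "fusion M r \<cdot> \<mu> T M = (r \<otimes> \<i> ?I) \<cdot> (T\<^sub>2 T M \<one> \<cdot> \<mu> T (M \<odot> \<one>))"
    by (simp add: fusion_def)
  also have "\<dots> = ((r \<otimes> \<i> ?I) \<cdot> (\<mu> T M \<otimes> \<mu> T \<one>))
      \<cdot> (T\<^sub>2 T (on_obj T M) ?I \<cdot> on_arr T (T\<^sub>2 T M \<one>))"
    by (simp add: T2_mu del: tensor_obj_simps(5))
  \<comment> \<open>The identity is kept under \<open>on_arr T\<close> so that naturality of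
    \<open>T\<^sub>2\<close> applies afterwards.\<close>
  also have "(r \<otimes> \<i> ?I) \<cdot> (\<mu> T M \<otimes> \<mu> T \<one>)
      = (r \<otimes> \<mu> T \<one>) \<cdot> (on_arr T r \<otimes> on_arr T (\<i> ?I))"
    by (simp add: interchange T_moduleD(5)[OF M])
  also have "\<dots> \<cdot> (T\<^sub>2 T (on_obj T M) ?I \<cdot> on_arr T (T\<^sub>2 T M \<one>))
      = (r \<otimes> \<mu> T \<one>) \<cdot> (((on_arr T r \<otimes> on_arr T (\<i> ?I)) \<cdot> T\<^sub>2 T (on_obj T M) ?I)
        \<cdot> on_arr T (T\<^sub>2 T M \<one>))"
    by simp
  also have "(on_arr T r \<otimes> on_arr T (\<i> ?I)) \<cdot> T\<^sub>2 T (on_obj T M) ?I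
      = T\<^sub>2 T M ?I \<cdot> on_arr T (r \<otimes> \<i> ?I)"
    by (rule T2_nat[symmetric]) simp_all
  finally show ?thesis
    by (simp add: fusion_def on_arr_comp_arr)
qed

lemma fusion_nat:
  assumes M: "T_module C T (M, r)" and N: "T_module C T (N, t)"
    and f: "T_linear C T (M, r) (N, t) f"
  shows "fusion N t \<cdot> on_arr T f = (f \<otimes> \<i> (on_obj T \<one>)) \<cdot> fusion M r"
proof -
  note [simp] = T_moduleD(1-4)[OF M] T_moduleD(1-4)[OF N] T_linearD(1-3)[OF f]
  let ?I = "on_obj T \<one>"
  \<comment> \<open>\<open>f\<close> is padded to \<open>f \<otimes> \<i> \<one>\<close> to fit
    naturality of \<open>T\<^sub>2\<close>.\<close>
  have "fusion N t \<cdot> on_arr T f = (t \<otimes> \<i> ?I) \<cdot> (T\<^sub>2 T N \<one> \<cdot> on_arr T (f \<otimes> \<i> \<one>))"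
    by (simp add: fusion_def)
  also have "T\<^sub>2 T N \<one> \<cdot> on_arr T (f \<otimes> \<i> \<one>) = (on_arr T f \<otimes> \<i> ?I) \<cdot> T\<^sub>2 T M \<one>"
    by (simp add: T2_nat del: tensor_arr_simps)
  also have "(t \<otimes> \<i> ?I) \<cdot> \<dots> = ((t \<cdot> on_arr T f) \<otimes> \<i> ?I) \<cdot> T\<^sub>2 T M \<one>"
    by (simp add: whisker)
  also have "\<dots> = (f \<otimes> \<i> ?I) \<cdot> fusion M r"
    by (simp add: fusion_def whisker flip: T_linearD(4)[OF f])
  finally show ?thesis .
qed

text \<open>\<open>T\<^sub>0 T\<close> slides past \<open>r\<close> and is absorbed by
  \<open>T\<^sub>2\<close> through the counit law.\<close>

lemma counit_fusion:
  assumes M: "T_module C T (M, r)"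
  shows "(\<i> M \<otimes> T\<^sub>0 T) \<cdot> fusion M r = r"
proof -
  note [simp] = T_moduleD(1-4)[OF M]
  have "(\<i> M \<otimes> T\<^sub>0 T) \<cdot> fusion M r = r \<cdot> ((\<i> (on_obj T M) \<otimes> T\<^sub>0 T) \<cdot> T\<^sub>2 T M \<one>)"
    using slide[of r "T\<^sub>0 T"] by (simp add: fusion_def flip: comp_assoc_arr)
  then show ?thesis
    by (simp add: T2_counit_right)
qed

text \<open>A cointegral is linear from the unit module to the free module on \<open>\<one>\<close>,
  and tensoring with the identity of \<open>M\<close> preserves linearity for the tensor product
  actions.\<close>

lemma cointegral_linear:
  assumes M: "T_module C T (M, r)" and \<Lambda>: "cointegral C T \<Lambda>"
  shows "(r \<otimes> \<mu> T \<one>) \<cdot> (T\<^sub>2 T M (on_obj T \<one>) \<cdot> on_arr T (\<i> M \<otimes> \<Lambda>)) = (\<i> M \<otimes> \<Lambda>) \<cdot> r"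
proof -
  note [simp] = T_moduleD(1-4)[OF M]
  have [simp]: "\<Lambda> \<in> arr C" "source C \<Lambda> = \<one>" "target C \<Lambda> = on_obj T \<one>"
    and lin: "\<mu> T \<one> \<cdot> on_arr T \<Lambda> = \<Lambda> \<cdot> T\<^sub>0 T"
    using \<Lambda> by (auto simp: cointegral_def in_hom_iff)
  have "(r \<otimes> \<mu> T \<one>) \<cdot> (T\<^sub>2 T M (on_obj T \<one>) \<cdot> on_arr T (\<i> M \<otimes> \<Lambda>))
      = ((r \<otimes> \<mu> T \<one>) \<cdot> (\<i> (on_obj T M) \<otimes> on_arr T \<Lambda>)) \<cdot> T\<^sub>2 T M \<one>"
    by (simp add: T2_nat)
  also have "(r \<otimes> \<mu> T \<one>) \<cdot> (\<i> (on_obj T M) \<otimes> on_arr T \<Lambda>)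
      = (\<i> M \<otimes> \<Lambda>) \<cdot> (\<i> M \<otimes> T\<^sub>0 T) \<cdot> (r \<otimes> \<i> (on_obj T \<one>))"
    by (simp add: interchange lin)
  also have "\<dots> \<cdot> T\<^sub>2 T M \<one> = (\<i> M \<otimes> \<Lambda>) \<cdot> ((\<i> M \<otimes> T\<^sub>0 T) \<cdot> fusion M r)"
    by (simp add: fusion_def)
  also have "\<dots> = (\<i> M \<otimes> \<Lambda>) \<cdot> r"
    by (simp only: counit_fusion[OF M])
  finally show ?thesis .
qed

text \<open>The inverse of fusion enters as a parameter \<open>G\<close>, which keeps antipodes out
  of the argument. Fusion sends the candidate section to \<open>\<i> M \<otimes> \<Lambda>\<close>;
  since fusion can be cancelled on the left, linearity and naturality may be checked after composing
  with it.\<close>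

lemma cointegral_imp_separable:
  assumes \<Lambda>: "cointegral C T \<Lambda>" and norm: "T\<^sub>0 T \<cdot> \<Lambda> = \<i> \<one>"
    and inv: "\<And>M r. T_module C T (M, r) \<Longrightarrow> G M r \<in> hom C (M \<odot> on_obj T \<one>) (on_obj T M) \<and>
      fusion M r \<cdot> G M r = \<i> (M \<odot> on_obj T \<one>) \<and> G M r \<cdot> fusion M r = \<i> (on_obj T M)"
  shows "separable_monad C T"
proof (rule separableI)
  let ?I = "on_obj T \<one>"
  have [simp]: "\<Lambda> \<in> arr C" "source C \<Lambda> = \<one>" "target C \<Lambda> = ?I"
    using \<Lambda> by (auto simp: cointegral_def in_hom_iff)
  define \<sigma> where "\<sigma> M r = G M r \<cdot> (\<i> M \<otimes> \<Lambda>)" for M r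
  have G_typing [simp]: "G M r \<in> arr C" "source C (G M r) = M \<odot> ?I"
      "target C (G M r) = on_obj T M"
    and fusion_G: "fusion M r \<cdot> G M r = \<i> (M \<odot> ?I)"
    and G_fusion: "G M r \<cdot> fusion M r = \<i> (on_obj T M)" if "T_module C T (M, r)" for M r
    using inv[OF that] by (auto simp: in_hom_iff)
  have fusion_inj: "f = g"
    if M: "T_module C T (M, r)" and "f \<in> arr C" "g \<in> arr C" "target C f = on_obj T M"
      "target C g = on_obj T M" and eq: "fusion M r \<cdot> f = fusion M r \<cdot> g" for M r f g
  proof -
    have "f = G M r \<cdot> fusion M r \<cdot> f" "g = G M r \<cdot> fusion M r \<cdot> g"
      using that by (simp_all add: G_fusion del: comp_assoc_arr)
    then show ?thesis
      using that by simp
  qed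
  have \<sigma>_typing [simp]: "\<sigma> M r \<in> arr C" "source C (\<sigma> M r) = M"
      "target C (\<sigma> M r) = on_obj T M"
    and fusion_\<sigma>: "fusion M r \<cdot> \<sigma> M r = \<i> M \<otimes> \<Lambda>" if M: "T_module C T (M, r)" for M r
  proof -
    note [simp] = T_moduleD(1-4)[OF M]
    show "\<sigma> M r \<in> arr C" "source C (\<sigma> M r) = M" "target C (\<sigma> M r) = on_obj T M"
      using M by (simp_all add: \<sigma>_def)
    have "fusion M r \<cdot> \<sigma> M r = (fusion M r \<cdot> G M r) \<cdot> (\<i> M \<otimes> \<Lambda>)"
      using M by (simp add: \<sigma>_def)
    then show "fusion M r \<cdot> \<sigma> M r = \<i> M \<otimes> \<Lambda>"
      using M by (simp add: fusion_G)
  qed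
  show "T_linear C T (M, r) (on_obj T M, \<mu> T M) (\<sigma> M r)" if M: "T_module C T (M, r)" for M r
  proof -
    note [simp] = T_moduleD(1-4)[OF M] M
    have "fusion M r \<cdot> (\<mu> T M \<cdot> on_arr T (\<sigma> M r))
        = (fusion M r \<cdot> \<mu> T M) \<cdot> on_arr T (\<sigma> M r)"
      by simp
    also have "\<dots> = (r \<otimes> \<mu> T \<one>) \<cdot> (T\<^sub>2 T M ?I \<cdot> on_arr T (fusion M r \<cdot> \<sigma> M r))"
      by (simp add: fusion_linear on_arr_comp_arr)
    also have "\<dots> = (fusion M r \<cdot> \<sigma> M r) \<cdot> r"
      by (simp only: fusion_\<sigma>[OF M] cointegral_linear[OF M \<Lambda>])
    also have "\<dots> = fusion M r \<cdot> (\<sigma> M r \<cdot> r)"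
      by simp
    finally have "fusion M r \<cdot> (\<mu> T M \<cdot> on_arr T (\<sigma> M r)) = fusion M r \<cdot> (\<sigma> M r \<cdot> r)" .
    then have "\<mu> T M \<cdot> on_arr T (\<sigma> M r) = \<sigma> M r \<cdot> r"
      by (rule fusion_inj[OF M, rotated 4]) simp_all
    then show ?thesis
      by (simp add: T_linear_def in_hom_iff)
  qed
  show "r \<cdot> \<sigma> M r = \<i> M" if M: "T_module C T (M, r)" for M r
  proof -
    note [simp] = T_moduleD(1-4)[OF M] M
    \<comment> \<open>The action factors through fusion, which reduces the section law to the
      normalisation of \<open>\<Lambda>\<close>.\<close>
    have "r \<cdot> \<sigma> M r = ((\<i> M \<otimes> T\<^sub>0 T) \<cdot> fusion M r) \<cdot> \<sigma> M r"
      by (simp only: counit_fusion[OF M])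
    also have "\<dots> = (\<i> M \<otimes> T\<^sub>0 T) \<cdot> (\<i> M \<otimes> \<Lambda>)"
      by (simp add: fusion_\<sigma>)
    also have "\<dots> = \<i> M"
      by (simp add: interchange norm)
    finally show ?thesis .
  qed
  show "\<sigma> N t \<cdot> f = on_arr T f \<cdot> \<sigma> M r"
    if M: "T_module C T (M, r)" and N: "T_module C T (N, t)"
      and f: "T_linear C T (M, r) (N, t) f" for M r N t f
  proof (rule fusion_inj[OF N])
    note [simp] = T_moduleD(1-4)[OF M] M T_moduleD(1-4)[OF N] N T_linearD(1-3)[OF f]
    have "fusion N t \<cdot> (on_arr T f \<cdot> \<sigma> M r) = (fusion N t \<cdot> on_arr T f) \<cdot> \<sigma> M r"
      by simp
    also have "\<dots> = (f \<otimes> \<i> ?I) \<cdot> (\<i> M \<otimes> \<Lambda>)"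
      by (simp add: fusion_nat[OF M N f] fusion_\<sigma>)
    also have "\<dots> = (\<i> N \<otimes> \<Lambda>) \<cdot> f"
      using slide[of f \<Lambda>] by simp
    also have "\<dots> = (fusion N t \<cdot> \<sigma> N t) \<cdot> f"
      by (simp only: fusion_\<sigma>[OF N])
    also have "\<dots> = fusion N t \<cdot> (\<sigma> N t \<cdot> f)"
      by simp
    finally show "fusion N t \<cdot> (\<sigma> N t \<cdot> f) = fusion N t \<cdot> (on_arr T f \<cdot> \<sigma> M r)" ..
  qed (use T_moduleD(1-4)[OF M] M T_moduleD(1-4)[OF N] N T_linearD(1-3)[OF f] in simp_all)
qed

end

section \<open>Right Hopf monads: dual modules and the inverse of fusion\<close>

locale right_hopf = right_autonomous_category C + bimonad C T
  for C :: "('o, 'a, 'x) rautcat_scheme" (structure)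
    and T :: "('o, 'a, 'y) bimnd_scheme" +
  fixes s :: "'o \<Rightarrow> 'a"
  assumes antipode: "right_antipode C T s"
begin

lemma s_typing [simp]:
  assumes "X \<in> obj C"
  shows "s X \<in> arr C" "source C (s X) = on_obj T (rdual C (on_obj T X))"
    "target C (s X) = rdual C X"
  using antipode assms by (auto simp: right_antipode_def in_hom_iff)

lemma s_nat:
  "f \<in> hom C X Y \<Longrightarrow> s X \<cdot> on_arr T (rdual_arr C (on_arr T f)) = rdual_arr C f \<cdot> s Y"
  using antipode by (simp add: right_antipode_def)

lemma antipode_ev:
  "X \<in> obj C \<Longrightarrow> T\<^sub>0 T \<cdot> on_arr T (ev C X) \<cdot> on_arr T (\<i> X \<otimes> rdual_arr C (\<eta> T X))
    = ev C (on_obj T X)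
      \<cdot> (\<i> (on_obj T X) \<otimes> (s (on_obj T X) \<cdot> on_arr T (rdual_arr C (\<mu> T X))))
      \<cdot> T\<^sub>2 T X (rdual C (on_obj T X))"
  using antipode by (simp add: right_antipode_def)

lemma antipode_coev:
  "X \<in> obj C \<Longrightarrow> (\<i> (rdual C X) \<otimes> \<eta> T X) \<cdot> coev C X \<cdot> T\<^sub>0 T
    = (s X \<otimes> \<mu> T X) \<cdot> T\<^sub>2 T (rdual C (on_obj T X)) (on_obj T X)
      \<cdot> on_arr T (coev C (on_obj T X))"
  using antipode by (simp add: right_antipode_def)

text \<open>The standard module structure on the right dual of \<open>(M, r)\<close>; it is used
  through linearity of evaluation and coevaluation.\<close>

definition dual_action :: "'o \<Rightarrow> 'a \<Rightarrow> 'a" where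
  "dual_action M r = s M \<cdot> on_arr T (rdual_arr C r)"

lemma dual_action_typing [simp]:
  assumes "T_module C T (M, r)"
  shows "dual_action M r \<in> arr C" "source C (dual_action M r) = on_obj T (rdual C M)"
    "target C (dual_action M r) = rdual C M"
  using T_moduleD[OF assms] by (simp_all add: dual_action_def)

text \<open>The antipode axiom speaks of evaluation at T(M). Transposing \<open>r\<close> carries
  evaluation at \<open>M\<close> to that situation, and the unit in the axiom cancels
  \<open>r\<close> at the end.\<close>

lemma ev_linear:
  assumes M: "T_module C T (M, r)"
  shows "ev C M \<cdot> ((r \<otimes> dual_action M r) \<cdot> T\<^sub>2 T M (rdual C M)) = T\<^sub>0 T \<cdot> on_arr T (ev C M)"
proof -
  note [simp] = T_moduleD(1-4)[OF M] M
  let ?TM = "on_obj T M" and ?M = "rdual C M" and ?r = "rdual_arr C r"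
  let ?TM' = "rdual C ?TM"
  have r: "r \<in> hom C ?TM M" by (simp add: in_hom_iff)
  \<comment> \<open>Naturality of \<open>s\<close> at \<open>r\<close> brings both transposes under
    \<open>on_arr T\<close>; the module law then produces the transpose of \<open>\<mu> T M\<close>
    that occurs in \<open>antipode_ev\<close>.\<close>
  have "?r \<cdot> dual_action M r = (?r \<cdot> s M) \<cdot> on_arr T ?r"
    by (simp add: dual_action_def)
  also have "\<dots> = s ?TM \<cdot> on_arr T (rdual_arr C (r \<cdot> on_arr T r))"
    by (simp add: s_nat[OF r, symmetric] on_arr_comp_arr
        rdual_arr_comp[of "on_arr T r" "on_obj T ?TM" ?TM r M] in_hom_iff)
  also have "\<dots> = s ?TM \<cdot> on_arr T (rdual_arr C (\<mu> T M)) \<cdot> on_arr T ?r"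
    by (simp add: T_moduleD(5)[OF M] on_arr_comp_arr
        rdual_arr_comp[of "\<mu> T M" "on_obj T ?TM" ?TM r M] in_hom_iff)
  finally have act: "?r \<cdot> dual_action M r = s ?TM \<cdot> on_arr T (rdual_arr C (\<mu> T M)) \<cdot> on_arr T ?r" .
  have "r \<otimes> dual_action M r = (r \<otimes> \<i> ?M) \<cdot> (\<i> ?TM \<otimes> dual_action M r)"
    by (simp add: interchange)
  then have "ev C M \<cdot> ((r \<otimes> dual_action M r) \<cdot> T\<^sub>2 T M ?M)
      = (ev C M \<cdot> (r \<otimes> \<i> ?M)) \<cdot> ((\<i> ?TM \<otimes> dual_action M r) \<cdot> T\<^sub>2 T M ?M)"
    by simp
  also have "ev C M \<cdot> (r \<otimes> \<i> ?M) = ev C ?TM \<cdot> (\<i> ?TM \<otimes> ?r)"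
    by (simp add: ev_rdual_arr[OF r])
  also have "\<dots> \<cdot> ((\<i> ?TM \<otimes> dual_action M r) \<cdot> T\<^sub>2 T M ?M)
      = ev C ?TM \<cdot> ((\<i> ?TM \<otimes> (?r \<cdot> dual_action M r)) \<cdot> T\<^sub>2 T M ?M)"
    by (simp add: whisker)
  also have "\<dots> = ev C ?TM \<cdot> ((\<i> ?TM \<otimes> (s ?TM \<cdot> on_arr T (rdual_arr C (\<mu> T M))))
      \<cdot> ((on_arr T (\<i> M) \<otimes> on_arr T ?r) \<cdot> T\<^sub>2 T M ?M))"
    by (simp add: act whisker)
  also have "(on_arr T (\<i> M) \<otimes> on_arr T ?r) \<cdot> T\<^sub>2 T M ?M = T\<^sub>2 T M ?TM' \<cdot> on_arr T (\<i> M \<otimes> ?r)"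
    by (rule T2_nat[symmetric]) simp_all
  also have "ev C ?TM \<cdot> ((\<i> ?TM \<otimes> (s ?TM \<cdot> on_arr T (rdual_arr C (\<mu> T M)))) \<cdot> \<dots>)
      = (ev C ?TM \<cdot> (\<i> ?TM \<otimes> (s ?TM \<cdot> on_arr T (rdual_arr C (\<mu> T M)))) \<cdot> T\<^sub>2 T M ?TM')
        \<cdot> on_arr T (\<i> M \<otimes> ?r)"
    by simp
  also have "\<dots> = T\<^sub>0 T \<cdot> on_arr T (ev C M) \<cdot> on_arr T (\<i> M \<otimes> rdual_arr C (\<eta> T M))
      \<cdot> on_arr T (\<i> M \<otimes> ?r)"
    by (simp only: antipode_ev T_moduleD(1)[OF M])
  \<comment> \<open>The transposes of \<open>\<eta> T M\<close> and \<open>r\<close> combine into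
    that of \<open>r \<cdot> \<eta> T M\<close>, an identity.\<close>
  also have "\<dots> = T\<^sub>0 T \<cdot> (on_arr T (ev C M) \<cdot> on_arr T (\<i> M \<otimes> rdual_arr C (r \<cdot> \<eta> T M)))"
    by (simp add: rdual_arr_comp[of "\<eta> T M" M ?TM r M] in_hom_iff whisker on_arr_comp_arr)
  also have "\<dots> = T\<^sub>0 T \<cdot> on_arr T (ev C M)"
    by (simp add: T_moduleD(6)[OF M])
  finally show ?thesis .
qed

text \<open>Dual to the evaluation case: \<open>coev_rdual_arr\<close> trades the transpose of
  \<open>r\<close> for \<open>r\<close> itself on coevaluation at T(M), the module law creates the
  \<open>\<mu> T M\<close> of \<open>antipode_coev\<close>, and \<open>r\<close> cancels the
  remaining unit.\<close>

lemma coev_linear: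
  assumes M: "T_module C T (M, r)"
  shows "(dual_action M r \<otimes> r) \<cdot> (T\<^sub>2 T (rdual C M) M \<cdot> on_arr T (coev C M)) = coev C M \<cdot> T\<^sub>0 T"
proof -
  note [simp] = T_moduleD(1-4)[OF M] M
  let ?TM = "on_obj T M" and ?M = "rdual C M" and ?r = "rdual_arr C r"
  let ?TM' = "rdual C ?TM"
  have r: "r \<in> hom C ?TM M" by (simp add: in_hom_iff)
  have "(dual_action M r \<otimes> r) \<cdot> (T\<^sub>2 T ?M M \<cdot> on_arr T (coev C M))
      = (s M \<otimes> r) \<cdot> (((on_arr T ?r \<otimes> on_arr T (\<i> M)) \<cdot> T\<^sub>2 T ?M M) \<cdot> on_arr T (coev C M))"
    by (simp add: dual_action_def interchange flip: comp_assoc_arr)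
  also have "(on_arr T ?r \<otimes> on_arr T (\<i> M)) \<cdot> T\<^sub>2 T ?M M = T\<^sub>2 T ?TM' M \<cdot> on_arr T (?r \<otimes> \<i> M)"
    by (rule T2_nat[symmetric]) simp_all
  also have "(s M \<otimes> r) \<cdot> (\<dots> \<cdot> on_arr T (coev C M))
      = (s M \<otimes> r) \<cdot> (T\<^sub>2 T ?TM' M \<cdot> on_arr T ((?r \<otimes> \<i> M) \<cdot> coev C M))"
    by (simp add: on_arr_comp_arr)
  also have "\<dots> = (s M \<otimes> r) \<cdot> ((T\<^sub>2 T ?TM' M \<cdot> on_arr T (\<i> ?TM' \<otimes> r)) \<cdot> on_arr T (coev C ?TM))"
    by (simp add: coev_rdual_arr[OF r] on_arr_comp_arr)
  also have "\<dots> = ((s M \<otimes> r) \<cdot> (\<i> (on_obj T ?TM') \<otimes> on_arr T r))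
      \<cdot> (T\<^sub>2 T ?TM' ?TM \<cdot> on_arr T (coev C ?TM))"
    by (simp add: T2_nat)
  also have "(s M \<otimes> r) \<cdot> (\<i> (on_obj T ?TM') \<otimes> on_arr T r) = (\<i> ?M \<otimes> r) \<cdot> (s M \<otimes> \<mu> T M)"
    by (simp add: interchange T_moduleD(5)[OF M])
  also have "\<dots> \<cdot> (T\<^sub>2 T ?TM' ?TM \<cdot> on_arr T (coev C ?TM))
      = (\<i> ?M \<otimes> r) \<cdot> ((s M \<otimes> \<mu> T M) \<cdot> T\<^sub>2 T ?TM' ?TM \<cdot> on_arr T (coev C ?TM))"
    by simp
  also have "\<dots> = (\<i> ?M \<otimes> r) \<cdot> ((\<i> ?M \<otimes> \<eta> T M) \<cdot> coev C M \<cdot> T\<^sub>0 T)"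
    by (simp only: antipode_coev T_moduleD(1)[OF M])
  also have "\<dots> = (\<i> ?M \<otimes> (r \<cdot> \<eta> T M)) \<cdot> (coev C M \<cdot> T\<^sub>0 T)"
    by (simp add: whisker)
  also have "\<dots> = coev C M \<cdot> T\<^sub>0 T"
    by (simp add: T_moduleD(6)[OF M])
  finally show ?thesis .
qed

text \<open>
  The transpose, under the duality between \<open>M\<close> and \<open>M\<^sup>\<or>\<close>, of the morphism
  \<open>T \<one> \<rightarrow> T(M\<^sup>\<or> \<otimes> M) \<rightarrow> T(M\<^sup>\<or>) \<otimes> T M \<rightarrow> M\<^sup>\<or> \<otimes> T M\<close>.
\<close>

definition fusion_inv :: "'o \<Rightarrow> 'a \<Rightarrow> 'a" where
  "fusion_inv M r = (ev C M \<otimes> \<i> (on_obj T M)) \<cdot>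
    (\<i> M \<otimes> ((dual_action M r \<otimes> \<i> (on_obj T M)) \<cdot> (T\<^sub>2 T (rdual C M) M \<cdot> on_arr T (coev C M))))"

lemma fusion_inv_typing [simp]:
  assumes "T_module C T (M, r)"
  shows "fusion_inv M r \<in> arr C" "source C (fusion_inv M r) = M \<odot> on_obj T \<one>"
    "target C (fusion_inv M r) = on_obj T M"
  using assms T_moduleD[OF assms] by (simp_all add: fusion_inv_def)

text \<open>Fusion slides past the evaluation and acts inside the transpose, where linearity of
  coevaluation leaves only \<open>T\<^sub>0 T\<close> and a zigzag.\<close>

lemma fusion_fusion_inv:
  assumes M: "T_module C T (M, r)"
  shows "fusion M r \<cdot> fusion_inv M r = \<i> (M \<odot> on_obj T \<one>)"
proof -
  note [simp] = T_moduleD(1-4)[OF M] M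
  let ?TM = "on_obj T M" and ?M = "rdual C M" and ?I = "on_obj T \<one>"
  let ?k = "(dual_action M r \<otimes> \<i> ?TM) \<cdot> (T\<^sub>2 T ?M M \<cdot> on_arr T (coev C M))"
  have "fusion M r \<cdot> fusion_inv M r
      = (fusion M r \<cdot> (ev C M \<otimes> \<i> ?TM)) \<cdot> (\<i> M \<otimes> ?k)"
    by (simp add: fusion_inv_def)
  also have "fusion M r \<cdot> (ev C M \<otimes> \<i> ?TM)
      = (ev C M \<otimes> \<i> (M \<odot> ?I)) \<cdot> (\<i> (M \<odot> ?M) \<otimes> fusion M r)"
    using slide[of "ev C M" "fusion M r"] by simp
  also have "\<dots> \<cdot> (\<i> M \<otimes> ?k)
      = (ev C M \<otimes> \<i> (M \<odot> ?I)) \<cdot> (\<i> M \<otimes> ((\<i> ?M \<otimes> fusion M r) \<cdot> ?k))"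
    by (simp add: whisker)
  also have "(\<i> ?M \<otimes> fusion M r) \<cdot> ?k
      = ((\<i> ?M \<otimes> fusion M r) \<cdot> (dual_action M r \<otimes> \<i> ?TM))
        \<cdot> (T\<^sub>2 T ?M (M \<odot> \<one>) \<cdot> on_arr T (coev C M))"
    by simp
  also have "(\<i> ?M \<otimes> fusion M r) \<cdot> (dual_action M r \<otimes> \<i> ?TM)
      = (dual_action M r \<otimes> (r \<otimes> \<i> ?I)) \<cdot> (\<i> (on_obj T ?M) \<otimes> T\<^sub>2 T M \<one>)"
    by (simp add: interchange fusion_def)
  also have "\<dots> \<cdot> (T\<^sub>2 T ?M (M \<odot> \<one>) \<cdot> on_arr T (coev C M))
      = (dual_action M r \<otimes> (r \<otimes> \<i> ?I))
        \<cdot> (((\<i> (on_obj T ?M) \<otimes> T\<^sub>2 T M \<one>) \<cdot> T\<^sub>2 T ?M (M \<odot> \<one>)) \<cdot> on_arr T (coev C M))"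
    by simp
  \<comment> \<open>Coassociativity regroups the factors so that the two actions act together on the
    dual tensored with \<open>M\<close>, as \<open>coev_linear\<close> requires.\<close>
  also have "(\<i> (on_obj T ?M) \<otimes> T\<^sub>2 T M \<one>) \<cdot> T\<^sub>2 T ?M (M \<odot> \<one>)
      = (T\<^sub>2 T ?M M \<otimes> \<i> ?I) \<cdot> T\<^sub>2 T (?M \<odot> M) \<one>"
    by (simp only: T2_coassoc tensor_obj_simps(1) T_moduleD(1)[OF M] duality_typing(1))
  also have "(dual_action M r \<otimes> (r \<otimes> \<i> ?I)) \<cdot> (\<dots> \<cdot> on_arr T (coev C M))
      = ((dual_action M r \<otimes> r) \<otimes> \<i> ?I)
        \<cdot> ((T\<^sub>2 T ?M M \<otimes> \<i> ?I) \<cdot> (T\<^sub>2 T (?M \<odot> M) \<one> \<cdot> on_arr T (coev C M \<otimes> \<i> \<one>)))"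
    by simp
  also have "T\<^sub>2 T (?M \<odot> M) \<one> \<cdot> on_arr T (coev C M \<otimes> \<i> \<one>)
      = (on_arr T (coev C M) \<otimes> on_arr T (\<i> \<one>)) \<cdot> T\<^sub>2 T \<one> \<one>"
    by (rule T2_nat) simp_all
  also have "((dual_action M r \<otimes> r) \<otimes> \<i> ?I) \<cdot> ((T\<^sub>2 T ?M M \<otimes> \<i> ?I) \<cdot> \<dots>)
      = (((dual_action M r \<otimes> r) \<cdot> (T\<^sub>2 T ?M M \<cdot> on_arr T (coev C M))) \<otimes> \<i> ?I) \<cdot> T\<^sub>2 T \<one> \<one>"
    by (simp add: whisker)
  also have "\<dots> = (coev C M \<otimes> \<i> ?I) \<cdot> ((T\<^sub>0 T \<otimes> \<i> ?I) \<cdot> T\<^sub>2 T \<one> \<one>)"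
    by (simp add: coev_linear[OF M] whisker)
  also have "\<dots> = coev C M \<otimes> \<i> ?I"
    by (simp add: T2_counit_left)
  also have "(ev C M \<otimes> \<i> (M \<odot> ?I)) \<cdot> (\<i> M \<otimes> \<dots>)
      = ((ev C M \<otimes> \<i> M) \<cdot> (\<i> M \<otimes> coev C M)) \<otimes> \<i> ?I"
    by (simp add: whisker)
  also have "\<dots> = \<i> (M \<odot> ?I)"
    by (simp add: zigzag_obj)
  finally show ?thesis .
qed

text \<open>Here coassociativity groups \<open>r\<close> with the dual action on the other side, so
  linearity of evaluation applies; the zigzag then happens under \<open>on_arr T\<close>.\<close>

lemma fusion_inv_fusion:
  assumes M: "T_module C T (M, r)"
  shows "fusion_inv M r \<cdot> fusion M r = \<i> (on_obj T M)"
proof -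
  note [simp] = T_moduleD(1-4)[OF M] M
  let ?TM = "on_obj T M" and ?M = "rdual C M" and ?I = "on_obj T \<one>"
  let ?k = "(dual_action M r \<otimes> \<i> ?TM) \<cdot> (T\<^sub>2 T ?M M \<cdot> on_arr T (coev C M))"
  have "fusion_inv M r \<cdot> fusion M r
      = (ev C M \<otimes> \<i> ?TM) \<cdot> (((\<i> M \<otimes> ?k) \<cdot> (r \<otimes> \<i> ?I)) \<cdot> T\<^sub>2 T M \<one>)"
    by (simp add: fusion_inv_def fusion_def)
  also have "(\<i> M \<otimes> ?k) \<cdot> (r \<otimes> \<i> ?I)
      = (r \<otimes> dual_action M r \<otimes> \<i> ?TM) \<cdot> ((\<i> ?TM \<otimes> T\<^sub>2 T ?M M) \<cdot> (\<i> ?TM \<otimes> on_arr T (coev C M)))"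
    by (simp add: interchange)
  also have "\<dots> \<cdot> T\<^sub>2 T M \<one>
      = (r \<otimes> dual_action M r \<otimes> \<i> ?TM) \<cdot> ((\<i> ?TM \<otimes> T\<^sub>2 T ?M M)
        \<cdot> ((on_arr T (\<i> M) \<otimes> on_arr T (coev C M)) \<cdot> T\<^sub>2 T M \<one>))"
    by simp
  also have "(on_arr T (\<i> M) \<otimes> on_arr T (coev C M)) \<cdot> T\<^sub>2 T M \<one>
      = T\<^sub>2 T M (?M \<odot> M) \<cdot> on_arr T (\<i> M \<otimes> coev C M)"
    by (rule T2_nat[symmetric]) simp_all
  also have "(\<i> ?TM \<otimes> T\<^sub>2 T ?M M) \<cdot> \<dots>
      = ((\<i> ?TM \<otimes> T\<^sub>2 T ?M M) \<cdot> T\<^sub>2 T M (?M \<odot> M)) \<cdot> on_arr T (\<i> M \<otimes> coev C M)"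
    by simp
  also have "(\<i> ?TM \<otimes> T\<^sub>2 T ?M M) \<cdot> T\<^sub>2 T M (?M \<odot> M)
      = (T\<^sub>2 T M ?M \<otimes> \<i> ?TM) \<cdot> T\<^sub>2 T (M \<odot> ?M) M"
    by (simp add: T2_coassoc)
  also have "(ev C M \<otimes> \<i> ?TM) \<cdot> ((r \<otimes> dual_action M r \<otimes> \<i> ?TM)
        \<cdot> (\<dots> \<cdot> on_arr T (\<i> M \<otimes> coev C M)))
      = ((ev C M \<cdot> ((r \<otimes> dual_action M r) \<cdot> T\<^sub>2 T M ?M)) \<otimes> \<i> ?TM)
        \<cdot> (T\<^sub>2 T (M \<odot> ?M) M \<cdot> on_arr T (\<i> M \<otimes> coev C M))"
    by (simp add: whisker)
  also have "\<dots> = (T\<^sub>0 T \<otimes> \<i> ?TM) \<cdot> (((on_arr T (ev C M) \<otimes> on_arr T (\<i> M))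
      \<cdot> T\<^sub>2 T (M \<odot> ?M) M) \<cdot> on_arr T (\<i> M \<otimes> coev C M))"
    by (simp add: ev_linear[OF M] whisker)
  also have "(on_arr T (ev C M) \<otimes> on_arr T (\<i> M)) \<cdot> T\<^sub>2 T (M \<odot> ?M) M
      = T\<^sub>2 T \<one> M \<cdot> on_arr T (ev C M \<otimes> \<i> M)"
    by (rule T2_nat[symmetric]) simp_all
  also have "(T\<^sub>0 T \<otimes> \<i> ?TM) \<cdot> (\<dots> \<cdot> on_arr T (\<i> M \<otimes> coev C M))
      = ((T\<^sub>0 T \<otimes> \<i> ?TM) \<cdot> T\<^sub>2 T \<one> M) \<cdot> on_arr T ((ev C M \<otimes> \<i> M) \<cdot> (\<i> M \<otimes> coev C M))"
    by (simp add: on_arr_comp_arr)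
  also have "\<dots> = \<i> ?TM"
    by (simp add: T2_counit_left zigzag_obj)
  finally show ?thesis .
qed

end

section \<open>Equivalence of the three conditions\<close>

theorem theorem6p5:
  fixes C :: "('o, 'a) rautcat" and T :: "('o, 'a) bimnd"
  assumes "right_autonomous_category C"
    and "right_hopf_monad C T"
  shows "(semisimple_monad C T \<longleftrightarrow> separable_monad C T) \<and>
    (separable_monad C T \<longleftrightarrow>
      (\<exists>\<Lambda>. cointegral C T \<Lambda> \<and> T\<^sub>0 T \<cdot>\<^bsub>C\<^esub> \<Lambda> = \<i>\<^bsub>C\<^esub> \<one>\<^bsub>C\<^esub>))"
proof -
  obtain s where "bimonad C T" and "right_antipode C T s"
    using assms(2) by (auto simp: right_hopf_monad_def)
  with assms(1) interpret right_hopf C T s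
    by (simp add: right_hopf_def right_hopf_axioms_def)
  \<comment> \<open>This closes the cycle from separable to semisimple to a normalised cointegral
    and back, with \<open>fusion_inv\<close> as the inverse of fusion.\<close>
  have "separable_monad C T" if "cointegral C T \<Lambda>" "T\<^sub>0 T \<cdot>\<^bsub>C\<^esub> \<Lambda> = \<i>\<^bsub>C\<^esub> \<one>\<^bsub>C\<^esub>" for \<Lambda>
    using that by (rule cointegral_imp_separable[where G = fusion_inv])
      (simp add: in_hom_iff fusion_fusion_inv fusion_inv_fusion)
  then show ?thesis
    using separable_imp_semisimple semisimple_imp_cointegral by blast
qed

end
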